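(* Let $\theta \ge 0$ and $K>0$ be integers. Consider a two-color (black/white) Pólya urn with random replacement matrix $$\begin{pmatrix} \mathcal{A} & \theta-\mathcal{A}\\ \theta-\mathcal{D} & \mathcal{D}\end{pmatrix},$$ where $\mathcal{A}$ and $\mathcal{D}$ are integer-valued random variables with $\Pr(\mathcal{A}=k)=\pi_k$ and $\Pr(\mathcal{D}=k)=\tau_k$ for $-K\le k\le \theta$ (so $\sum_{k=-K}^{\theta}\pi_k=\sum_{k=-K}^{\theta}\tau_k=1$). Assume the urn, started from the deterministic configuration $(B_0,W_0)=(b_0,w_0)$, is tenable. Let $$Q(x,y,z)=\sum_{n=0}^{\infty}\sum_{b,w\ge 0} s_0s_1\cdots s_{n-1}\,\Pr(B_n=b,W_n=w)\,x^b y^w\frac{z^n}{n!},\qquad s_j=b_0+w_0+\theta j,$$ (the empty product for $n=0$ being $1$). Let $x,y$ be complex numbers with $xy\neq 0$, and let $(X(t),Y(t))$ be the solution of the differential system $$X'(t)=\sum_{k=-K}^{\theta}\pi_k\,X(t)^{k+1}Y(t)^{\theta-k},\qquad Y'(t)=\sum_{k=-K}^{\theta}\tau_k\,X(t)^{\theta-k}Y(t)^{k+1},$$ with initial conditions $X(0)=x$, $Y(0)=y$. Then $$Q(x,y,z)=X(z)^{b_0}\,Y(z)^{w_0}$$ (as power series in $z$ around $z=0$).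
   Context: The urn contains black and white balls; $(B_n,W_n)$ denotes the numbers of black and white balls after $n$ draws. At each step a ball is drawn uniformly at random and put back; if it is black, an independent fresh realization $k$ of $\mathcal{A}$ is generated and $k$ black balls and $\theta-k$ white balls are added (negative numbers meaning removal); if it is white, an independent fresh realization $k$ of $\mathcal{D}$ is generated and $\theta-k$ black balls and $k$ white balls are added. The random variables are generated independently at each step. The urn is balanced with balance $\theta$, so the total number of balls after $n$ draws is deterministic and equals $s_n=b_0+w_0+\theta n$. The urn is called tenable if it never reaches a configuration in which a rule chosen with positive probability cannot be applied because there are not enough balls. *)

theory Defs
  imports "HOL-Probability.Probability" "HOL-Analysis.FPS_Convergence"
begin

text \<open>
  A configuration \<open>(b, w)\<close> is a pair of integers, so that the addition rules never truncate;
  tenability guarantees that all reachable configurations are nonnegative.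
  The laws of \<open>\<A>\<close> and \<open>\<D>\<close> are given as probability mass functions.
\<close>

definition add_black_rule :: "nat \<Rightarrow> int \<times> int \<Rightarrow> int \<Rightarrow> int \<times> int" where
  "add_black_rule \<theta> c k = (fst c + k, snd c + (int \<theta> - k))"

definition add_white_rule :: "nat \<Rightarrow> int \<times> int \<Rightarrow> int \<Rightarrow> int \<times> int" where
  "add_white_rule \<theta> c k = (fst c + (int \<theta> - k), snd c + k)"

text \<open>No ball can be drawn from an empty urn; by convention it then stays empty.\<close>

definition urn_step :: "nat \<Rightarrow> int pmf \<Rightarrow> int pmf \<Rightarrow> int \<times> int \<Rightarrow> (int \<times> int) pmf" where
  "urn_step \<theta> \<A> \<D> c =
     (if c = (0, 0) then return_pmf c
      else bind_pmf (bernoulli_pmf (real_of_int (fst c) / real_of_int (fst c + snd c)))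
             (\<lambda>black. if black then map_pmf (add_black_rule \<theta> c) \<A>
                               else map_pmf (add_white_rule \<theta> c) \<D>))"

text \<open>The joint law of \<open>(B\<^sub>n, W\<^sub>n)\<close>; binding a fresh step at each stage
  expresses the independence of the realizations.\<close>

primrec urn_law :: "nat \<Rightarrow> int pmf \<Rightarrow> int pmf \<Rightarrow> nat \<Rightarrow> nat \<Rightarrow> nat \<Rightarrow> (int \<times> int) pmf" where
  "urn_law \<theta> \<A> \<D> b0 w0 0 = return_pmf (int b0, int w0)"
| "urn_law \<theta> \<A> \<D> b0 w0 (Suc n) = bind_pmf (urn_law \<theta> \<A> \<D> b0 w0 n) (urn_step \<theta> \<A> \<D>)"

definition admissible :: "int \<times> int \<Rightarrow> bool" where
  "admissible c \<longleftrightarrow> fst c \<ge> 0 \<and> snd c \<ge> 0"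

definition tenable :: "nat \<Rightarrow> int pmf \<Rightarrow> int pmf \<Rightarrow> nat \<Rightarrow> nat \<Rightarrow> bool" where
  "tenable \<theta> \<A> \<D> b0 w0 \<longleftrightarrow>
     (\<forall>n. \<forall>c \<in> set_pmf (urn_law \<theta> \<A> \<D> b0 w0 n).
        (fst c > 0 \<longrightarrow> (\<forall>k \<in> set_pmf \<A>. admissible (add_black_rule \<theta> c k))) \<and>
        (snd c > 0 \<longrightarrow> (\<forall>k \<in> set_pmf \<D>. admissible (add_white_rule \<theta> c k))))"

definition total_balls :: "nat \<Rightarrow> nat \<Rightarrow> nat \<Rightarrow> nat \<Rightarrow> nat" where
  "total_balls \<theta> b0 w0 j = b0 + w0 + \<theta> * j"

text \<open>\<open>Q(x, y, z)\<close> as a power series in \<open>z\<close> for fixed \<open>x\<close> and \<open>y\<close>.\<close>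

definition urn_gf ::
    "nat \<Rightarrow> int pmf \<Rightarrow> int pmf \<Rightarrow> nat \<Rightarrow> nat \<Rightarrow> complex \<Rightarrow> complex \<Rightarrow> complex fps" where
  "urn_gf \<theta> \<A> \<D> b0 w0 x y = Abs_fps (\<lambda>n.
     (\<Sum>\<^sub>\<infinity>(b, w) \<in> (UNIV :: (nat \<times> nat) set).
        of_nat (\<Prod>j<n. total_balls \<theta> b0 w0 j) *
        of_real (pmf (urn_law \<theta> \<A> \<D> b0 w0 n) (int b, int w)) * x ^ b * y ^ w) / fact n)"

end

theory Submission
  imports Defs "HOL-Complex_Analysis.Cauchy_Integral_Formula"
begin

text \<open>
  Along a solution of the system, differentiating a monomial \<open>X\<^sup>b Y\<^sup>w\<close> yields \<open>b + w\<close> times the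
  expectation of \<open>X\<^sup>B Y\<^sup>W\<close> over the configuration \<open>(B, W)\<close> reached from \<open>(b, w)\<close> in one draw.
  Since the total number of balls is deterministic, iterating this shows that the \<open>n\<close>-th derivative
  of \<open>X\<^bsup>b0\<^esup> Y\<^bsup>w0\<^esup>\<close> is \<open>s\<^sub>0 \<cdots> s\<^bsub>n-1\<^esub>\<close> times the expectation of \<open>X\<^sup>B Y\<^sup>W\<close> for \<open>(B, W) = (B\<^sub>n, W\<^sub>n)\<close>;
  evaluating at \<open>0\<close> gives the Taylor coefficients.
\<close>

text \<open>Integer exponents match the integer configurations and obey the exponent laws as long as
  the bases are nonzero; on admissible configurations this is the ordinary monomial.\<close>

definition monomial_at :: "complex \<Rightarrow> complex \<Rightarrow> int \<times> int \<Rightarrow> complex" where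
  "monomial_at u v c = u powi fst c * v powi snd c"

section \<open>Support and total of the urn law\<close>

lemma finite_set_pmf_urn_step:
  assumes "finite (set_pmf \<A>)" "finite (set_pmf \<D>)"
  shows "finite (set_pmf (urn_step \<theta> \<A> \<D> c))"
  using assms by (auto simp: urn_step_def)

lemma finite_set_pmf_urn_law:
  assumes "finite (set_pmf \<A>)" "finite (set_pmf \<D>)"
  shows "finite (set_pmf (urn_law \<theta> \<A> \<D> b0 w0 n))"
  by (induction n) (auto intro: finite_set_pmf_urn_step assms)

lemma draw_probability_bounds:
  assumes "admissible c"
  shows "0 \<le> real_of_int (fst c) / real_of_int (fst c + snd c)"
    and "real_of_int (fst c) / real_of_int (fst c + snd c) \<le> 1"
  using assms by (auto simp: admissible_def divide_le_eq_1)

text \<open>A colour with no balls is drawn with probability 0. The positivity recorded in each case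
  is the premise under which \<open>tenable\<close> controls the next configuration.\<close>

lemma set_pmf_urn_step_cases:
  assumes "c' \<in> set_pmf (urn_step \<theta> \<A> \<D> c)" "admissible c" "c \<noteq> (0, 0)"
  obtains (black) k where "fst c > 0" "k \<in> set_pmf \<A>" "c' = add_black_rule \<theta> c k"
    | (white) k where "snd c > 0" "k \<in> set_pmf \<D>" "c' = add_white_rule \<theta> c k"
proof -
  let ?p = "real_of_int (fst c) / real_of_int (fst c + snd c)"
  have pos: "fst c + snd c > 0"
    using assms(2,3) by (cases c) (auto simp: admissible_def)
  obtain d where d: "d \<in> set_pmf (bernoulli_pmf ?p)"
      "c' \<in> set_pmf (if d then map_pmf (add_black_rule \<theta> c) \<A> else map_pmf (add_white_rule \<theta> c) \<D>)"
    using assms(1) unfolding urn_step_def if_not_P[OF assms(3)] set_bind_pmf by blast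
  have "pmf (bernoulli_pmf ?p) d \<noteq> 0"
    using d(1) by (simp add: set_pmf_iff)
  then have *: "if d then fst c > 0 else snd c > 0"
    using assms(2) draw_probability_bounds[OF assms(2)] pos
    by (cases d) (auto simp: admissible_def less_le)
  show thesis
    using d(2) * black white by (cases d) auto
qed

lemma urn_law_admissible:
  assumes "tenable \<theta> \<A> \<D> b0 w0" "c \<in> set_pmf (urn_law \<theta> \<A> \<D> b0 w0 n)"
  shows "admissible c"
  using assms(2)
proof (induction n arbitrary: c)
  case 0
  then show ?case by (simp add: admissible_def)
next
  case (Suc n)
  then obtain d where d: "d \<in> set_pmf (urn_law \<theta> \<A> \<D> b0 w0 n)" "c \<in> set_pmf (urn_step \<theta> \<A> \<D> d)"
    by auto
  show ?case
  proof (cases "d = (0, 0)")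
    case True
    then show ?thesis using d by (simp add: urn_step_def admissible_def)
  next
    case False
    show ?thesis
      using d(2) Suc.IH[OF d(1)] False
      by (cases rule: set_pmf_urn_step_cases) (use assms(1) d(1) in \<open>auto simp: tenable_def\<close>)
  qed
qed

lemma urn_law_total_balls:
  assumes "tenable \<theta> \<A> \<D> b0 w0" "b0 + w0 > 0" "c \<in> set_pmf (urn_law \<theta> \<A> \<D> b0 w0 n)"
  shows "fst c + snd c = int (total_balls \<theta> b0 w0 n)"
  using assms(3)
proof (induction n arbitrary: c)
  case 0
  then show ?case by (simp add: total_balls_def)
next
  case (Suc n)
  then obtain d where d: "d \<in> set_pmf (urn_law \<theta> \<A> \<D> b0 w0 n)" "c \<in> set_pmf (urn_step \<theta> \<A> \<D> d)"
    by auto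
  have total: "fst d + snd d = int (total_balls \<theta> b0 w0 n)"
    by (rule Suc.IH[OF d(1)])
  moreover have "total_balls \<theta> b0 w0 n > 0"
    using assms(2) by (auto simp: total_balls_def)
  ultimately have "d \<noteq> (0, 0)"
    by auto
  with d(2) urn_law_admissible[OF assms(1) d(1)] show ?case
    by (cases rule: set_pmf_urn_step_cases)
      (use total in \<open>auto simp: add_black_rule_def add_white_rule_def total_balls_def\<close>)
qed

section \<open>Differentiation along a solution\<close>

text \<open>Multiplying by the number of balls clears the denominator of the draw probability; the
  empty urn then fits too, both sides being 0.\<close>

lemma expectation_urn_step:
  fixes f :: "int \<times> int \<Rightarrow> complex"
  assumes "admissible c" and fin: "finite (set_pmf \<A>)" "finite (set_pmf \<D>)"
  shows "of_int (fst c + snd c) * measure_pmf.expectation (urn_step \<theta> \<A> \<D> c) f =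
           of_int (fst c) * measure_pmf.expectation \<A> (\<lambda>k. f (add_black_rule \<theta> c k)) +
           of_int (snd c) * measure_pmf.expectation \<D> (\<lambda>k. f (add_white_rule \<theta> c k))"
proof (cases "c = (0, 0)")
  case False
  define p where "p = real_of_int (fst c) / real_of_int (fst c + snd c)"
  have p: "0 \<le> p" "p \<le> 1"
    using draw_probability_bounds[OF assms(1)] by (simp_all add: p_def)
  have pos: "fst c + snd c > 0"
    using assms(1) False by (cases c) (auto simp: admissible_def)
  let ?EA = "measure_pmf.expectation \<A> (\<lambda>k. f (add_black_rule \<theta> c k))"
  let ?ED = "measure_pmf.expectation \<D> (\<lambda>k. f (add_white_rule \<theta> c k))"
  have "measure_pmf.expectation (urn_step \<theta> \<A> \<D> c) f = of_real p * ?EA + of_real (1 - p) * ?ED"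
    unfolding urn_step_def p_def[symmetric] using False p fin
    by (simp, subst pmf_expectation_bind[where A = UNIV]) (auto simp: UNIV_bool scaleR_conv_of_real)
  moreover have "of_int (fst c + snd c) * complex_of_real p = of_int (fst c)"
    using pos by (simp add: p_def flip: of_int_add)
  moreover from this have "of_int (fst c + snd c) * complex_of_real (1 - p) = of_int (snd c)"
    by (simp add: algebra_simps)
  ultimately show ?thesis
    by (simp only: distrib_left mult.assoc[symmetric])
qed auto

text \<open>The product rule supplies the factors \<open>fst c\<close> and \<open>snd c\<close>,
  which are the draw weights in \<open>expectation_urn_step\<close>; inserting the system for the
  two derivatives turns each summand into the monomial reached by one rule.\<close>

lemma has_field_derivative_monomial:
  fixes X Y :: "complex \<Rightarrow> complex"
  assumes "set_pmf \<A> \<subseteq> {- int K..int \<theta>}" "set_pmf \<D> \<subseteq> {- int K..int \<theta>}"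
    and X: "(X has_field_derivative
              (\<Sum>k = - int K..int \<theta>.
                 of_real (pmf \<A> k) * X t powi (k + 1) * Y t powi (int \<theta> - k))) (at t)"
    and Y: "(Y has_field_derivative
              (\<Sum>k = - int K..int \<theta>.
                 of_real (pmf \<D> k) * X t powi (int \<theta> - k) * Y t powi (k + 1))) (at t)"
    and nz: "X t \<noteq> 0" "Y t \<noteq> 0"
    and "admissible c"
  shows "((\<lambda>t. monomial_at (X t) (Y t) c) has_field_derivative
           of_int (fst c + snd c) *
             measure_pmf.expectation (urn_step \<theta> \<A> \<D> c) (monomial_at (X t) (Y t))) (at t)"
proof -
  let ?X' = "\<Sum>k = - int K..int \<theta>. of_real (pmf \<A> k) * X t powi (k + 1) * Y t powi (int \<theta> - k)"
  let ?Y' = "\<Sum>k = - int K..int \<theta>. of_real (pmf \<D> k) * X t powi (int \<theta> - k) * Y t powi (k + 1)"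
  let ?b = "fst c" and ?w = "snd c"
  have fin: "finite (set_pmf \<A>)" "finite (set_pmf \<D>)"
    using assms(1,2) by (auto intro: finite_subset)
  \<comment> \<open>The shifts cancel: (b - 1) + (k + 1) = b + k. For b = 0 the exponent -1 occurs,
    which is harmless since \<open>X t\<close> is nonzero.\<close>
  have black: "measure_pmf.expectation \<A> (\<lambda>k. monomial_at (X t) (Y t) (add_black_rule \<theta> c k)) =
                 X t powi (?b - 1) * Y t powi ?w * ?X'"
    unfolding sum_distrib_left
    by (subst integral_measure_pmf[of "{- int K..int \<theta>}"])
      (use assms(1) nz in \<open>auto simp: monomial_at_def add_black_rule_def scaleR_conv_of_real
         power_int_add power_int_diff field_simps intro!: sum.cong\<close>)
  have white: "measure_pmf.expectation \<D> (\<lambda>k. monomial_at (X t) (Y t) (add_white_rule \<theta> c k)) =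
                 X t powi ?b * Y t powi (?w - 1) * ?Y'"
    unfolding sum_distrib_left
    by (subst integral_measure_pmf[of "{- int K..int \<theta>}"])
      (use assms(2) nz in \<open>auto simp: monomial_at_def add_white_rule_def scaleR_conv_of_real
         power_int_add power_int_diff field_simps intro!: sum.cong\<close>)
  have "((\<lambda>t. X t powi ?b) has_field_derivative of_int ?b * X t powi (?b - 1) * ?X') (at t)"
    unfolding has_field_derivative_def
    by (rule has_derivative_eq_rhs[OF has_derivative_power_int[OF nz(1) X[unfolded has_field_derivative_def]]])
      (simp add: fun_eq_iff mult_ac)
  moreover have "((\<lambda>t. Y t powi ?w) has_field_derivative of_int ?w * Y t powi (?w - 1) * ?Y') (at t)"
    unfolding has_field_derivative_def
    by (rule has_derivative_eq_rhs[OF has_derivative_power_int[OF nz(2) Y[unfolded has_field_derivative_def]]])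
      (simp add: fun_eq_iff mult_ac)
  ultimately show ?thesis
    unfolding expectation_urn_step[OF \<open>admissible c\<close> fin] black white
    unfolding monomial_at_def
    by (rule DERIV_cong[OF DERIV_mult]) (simp only: mult_ac add.commute)
qed

text \<open>Each term of the finite expectation brings its own factor \<open>fst c + snd c\<close>.
  Balance makes this factor constant on the support, so it leaves the sum, and what remains is the
  expectation after one more draw.\<close>

lemma has_field_derivative_expectation_urn_law:
  fixes X Y :: "complex \<Rightarrow> complex"
  assumes "set_pmf \<A> \<subseteq> {- int K..int \<theta>}" "set_pmf \<D> \<subseteq> {- int K..int \<theta>}"
    and "tenable \<theta> \<A> \<D> b0 w0" "b0 + w0 > 0"
    and X: "(X has_field_derivative
              (\<Sum>k = - int K..int \<theta>.
                 of_real (pmf \<A> k) * X t powi (k + 1) * Y t powi (int \<theta> - k))) (at t)"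
    and Y: "(Y has_field_derivative
              (\<Sum>k = - int K..int \<theta>.
                 of_real (pmf \<D> k) * X t powi (int \<theta> - k) * Y t powi (k + 1))) (at t)"
    and nz: "X t \<noteq> 0" "Y t \<noteq> 0"
  shows "((\<lambda>t. measure_pmf.expectation (urn_law \<theta> \<A> \<D> b0 w0 n) (monomial_at (X t) (Y t)))
           has_field_derivative
           of_nat (total_balls \<theta> b0 w0 n) *
             measure_pmf.expectation (urn_law \<theta> \<A> \<D> b0 w0 (Suc n)) (monomial_at (X t) (Y t))) (at t)"
proof -
  let ?L = "urn_law \<theta> \<A> \<D> b0 w0 n"
  have finAD: "finite (set_pmf \<A>)" "finite (set_pmf \<D>)"
    using assms(1,2) by (auto intro: finite_subset)
  have fin: "finite (set_pmf ?L)"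
    by (rule finite_set_pmf_urn_law[OF finAD])
  have expand: "measure_pmf.expectation ?L (monomial_at (X t) (Y t)) =
      (\<Sum>c\<in>set_pmf ?L. of_real (pmf ?L c) * monomial_at (X t) (Y t) c)" for t
    by (subst integral_measure_pmf[OF fin]) (auto simp: scaleR_conv_of_real)
  have expand_Suc: "measure_pmf.expectation (urn_law \<theta> \<A> \<D> b0 w0 (Suc n)) (monomial_at (X t) (Y t)) =
      (\<Sum>c\<in>set_pmf ?L. of_real (pmf ?L c) *
         measure_pmf.expectation (urn_step \<theta> \<A> \<D> c) (monomial_at (X t) (Y t)))"
    by (simp, subst pmf_expectation_bind[OF fin])
      (auto simp: scaleR_conv_of_real intro: finite_set_pmf_urn_step finAD)
  have "((\<lambda>t. of_real (pmf ?L c) * monomial_at (X t) (Y t) c) has_field_derivative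
      of_nat (total_balls \<theta> b0 w0 n) * (of_real (pmf ?L c) *
        measure_pmf.expectation (urn_step \<theta> \<A> \<D> c) (monomial_at (X t) (Y t)))) (at t)"
    if c: "c \<in> set_pmf ?L" for c
    using DERIV_cmult[OF has_field_derivative_monomial[OF assms(1,2) X Y nz
            urn_law_admissible[OF assms(3) c]], of "of_real (pmf ?L c)"]
    unfolding urn_law_total_balls[OF assms(3,4) c] by (simp add: mult_ac)
  then show ?thesis
    unfolding expand expand_Suc sum_distrib_left by (rule DERIV_sum)
qed

section \<open>Coefficients of the generating function\<close>

text \<open>The support is finite and consists of nonnegative pairs, so the infinite sum over pairs
  of naturals collapses to an expectation.\<close>

lemma urn_gf_nth:
  assumes "finite (set_pmf \<A>)" "finite (set_pmf \<D>)" "tenable \<theta> \<A> \<D> b0 w0"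
  shows "fps_nth (urn_gf \<theta> \<A> \<D> b0 w0 x y) n =
           of_nat (\<Prod>j<n. total_balls \<theta> b0 w0 j) *
             measure_pmf.expectation (urn_law \<theta> \<A> \<D> b0 w0 n) (monomial_at x y) / fact n"
proof -
  let ?L = "urn_law \<theta> \<A> \<D> b0 w0 n" and ?p = "of_nat (\<Prod>j<n. total_balls \<theta> b0 w0 j) :: complex"
  let ?f = "\<lambda>(b, w). ?p * of_real (pmf ?L (int b, int w)) * x ^ b * y ^ w"
  \<comment> \<open>Inverse of the embedding of natural pairs into integer pairs; \<open>nat\<close>
    never truncates on the support.\<close>
  let ?h = "\<lambda>c :: int \<times> int. (nat (fst c), nat (snd c))"
  have fin: "finite (set_pmf ?L)"
    by (rule finite_set_pmf_urn_law[OF assms(1,2)])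
  have adm: "fst c \<ge> 0" "snd c \<ge> 0" if "c \<in> set_pmf ?L" for c
    using urn_law_admissible[OF assms(3) that] by (auto simp: admissible_def)
  have inj: "inj_on ?h (set_pmf ?L)"
    by (rule inj_onI) (metis adm eq_nat_nat_iff prod.inject prod_eqI)
  have outside: "?f z = 0" if "z \<in> UNIV - ?h ` set_pmf ?L" for z
  proof -
    obtain b w where z: "z = (b, w)" by (cases z)
    have "(int b, int w) \<notin> set_pmf ?L"
      using that z by force
    then show ?thesis by (simp add: z set_pmf_iff)
  qed
  have "(?f has_sum (\<Sum>z\<in>?h ` set_pmf ?L. ?f z)) UNIV"
    by (rule has_sum_finite_neutralI) (use fin outside in auto)
  then have "infsum ?f UNIV = (\<Sum>z\<in>?h ` set_pmf ?L. ?f z)"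
    by (rule infsumI)
  also have "\<dots> = (\<Sum>c\<in>set_pmf ?L. ?p * (pmf ?L c *\<^sub>R monomial_at x y c))"
    by (subst sum.reindex[OF inj], rule sum.cong)
      (simp_all add: adm monomial_at_def power_int_def scaleR_conv_of_real mult.assoc)
  also have "\<dots> = ?p * measure_pmf.expectation ?L (monomial_at x y)"
    by (subst integral_measure_pmf[OF fin]) (auto simp: sum_distrib_left)
  finally show ?thesis
    by (simp add: urn_gf_def)
qed

section \<open>Comparison with the Taylor series at 0\<close>

theorem theorem1:
  fixes \<theta> K b0 w0 :: nat
    and \<A> \<D> :: "int pmf"
    and x y :: complex
    and X Y :: "complex \<Rightarrow> complex"
  assumes "K > 0"
    and "set_pmf \<A> \<subseteq> {- int K..int \<theta>}"
    and "set_pmf \<D> \<subseteq> {- int K..int \<theta>}"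
    and "tenable \<theta> \<A> \<D> b0 w0"
    and "x * y \<noteq> 0"
    and "\<forall>\<^sub>F t in nhds 0.
           (X has_field_derivative
              (\<Sum>k = - int K..int \<theta>.
                 of_real (pmf \<A> k) * X t powi (k + 1) * Y t powi (int \<theta> - k))) (at t)"
    and "\<forall>\<^sub>F t in nhds 0.
           (Y has_field_derivative
              (\<Sum>k = - int K..int \<theta>.
                 of_real (pmf \<D> k) * X t powi (int \<theta> - k) * Y t powi (k + 1))) (at t)"
    and "X 0 = x" and "Y 0 = y"
  shows "(\<lambda>z. X z ^ b0 * Y z ^ w0) has_fps_expansion urn_gf \<theta> \<A> \<D> b0 w0 x y"
proof -
  let ?F = "\<lambda>z. X z ^ b0 * Y z ^ w0"
  let ?E = "\<lambda>n t. measure_pmf.expectation (urn_law \<theta> \<A> \<D> b0 w0 n) (monomial_at (X t) (Y t))"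
  let ?p = "\<lambda>n. of_nat (\<Prod>j<n. total_balls \<theta> b0 w0 j) :: complex"
  have fin: "finite (set_pmf \<A>)" "finite (set_pmf \<D>)"
    using assms(2,3) by (auto intro: finite_subset)
  have F_eq: "?F t = ?p 0 * ?E 0 t" for t
    by (simp add: monomial_at_def)
  show ?thesis
  proof (cases "b0 + w0 = 0")
    case True
    \<comment> \<open>The empty urn stays empty although \<open>s\<^sub>n = \<theta> n\<close>, but the factor \<open>s\<^sub>0 = 0\<close> hides this.\<close>
    have "fps_nth (urn_gf \<theta> \<A> \<D> b0 w0 x y) n = fps_nth 1 n" for n
      unfolding urn_gf_nth[OF fin assms(4)]
      using True by (cases n)
        (simp_all add: monomial_at_def total_balls_def prod.lessThan_Suc_shift
          del: urn_law.simps(2) prod.lessThan_Suc)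
    then have "urn_gf \<theta> \<A> \<D> b0 w0 x y = 1"
      by (rule fps_ext)
    then show ?thesis using True by simp
  next
    case False
    \<comment> \<open>The system at 0 itself yields continuity there, so \<open>X\<close> and
      \<open>Y\<close> stay nonzero nearby because \<open>x\<close> and \<open>y\<close>
      are.\<close>
    have "isCont X 0" "isCont Y 0"
      using eventually_nhds_x_imp_x[OF assms(6)] eventually_nhds_x_imp_x[OF assms(7)]
      by (auto intro: DERIV_isCont)
    then have "\<forall>\<^sub>F t in nhds 0. X t \<noteq> 0" "\<forall>\<^sub>F t in nhds 0. Y t \<noteq> 0"
      using assms(5,8,9)
      by (auto intro!: tendsto_imp_eventually_ne simp: isCont_def tendsto_at_iff_tendsto_nhds)
    \<comment> \<open>The conditions on \<open>t\<close> do not involve \<open>n\<close>, so a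
      single neighbourhood serves derivatives of all orders.\<close>
    with assms(6,7) have "\<forall>\<^sub>F t in nhds 0. \<forall>n.
        (?E n has_field_derivative of_nat (total_balls \<theta> b0 w0 n) * ?E (Suc n) t) (at t)"
    proof eventually_elim
      case (elim t)
      show ?case
        using has_field_derivative_expectation_urn_law[OF assms(2,3,4) _ elim] False by blast
    qed
    then obtain S where S: "open S" "0 \<in> S" and
      S_E: "\<And>n t. t \<in> S \<Longrightarrow>
        (?E n has_field_derivative of_nat (total_balls \<theta> b0 w0 n) * ?E (Suc n) t) (at t)"
      unfolding eventually_nhds by blast
    \<comment> \<open>Claimed on all of \<open>S\<close>, not only at 0: the next derivative at a
      point needs the formula on a neighbourhood of it. Each differentiation appends one factor to
      the product.\<close>
    have deriv_F: "(deriv ^^ n) ?F t = ?p n * ?E n t" if "t \<in> S" for n t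
      using that
    proof (induction n arbitrary: t)
      case 0
      then show ?case using F_eq by simp
    next
      case (Suc n)
      have "((\<lambda>t. ?p n * ?E n t) has_field_derivative
              ?p n * (of_nat (total_balls \<theta> b0 w0 n) * ?E (Suc n) t)) (at t)"
        by (intro DERIV_cmult S_E Suc.prems)
      then have "((deriv ^^ n) ?F has_field_derivative
              ?p n * (of_nat (total_balls \<theta> b0 w0 n) * ?E (Suc n) t)) (at t)"
        by (rule has_field_derivative_transform_within_open[OF _ S(1) Suc.prems]) (simp add: Suc.IH)
      then show ?case
        by (simp add: DERIV_imp_deriv)
    qed
    \<comment> \<open>Holomorphy ensures that the Taylor series at 0 represents \<open>?F\<close>,
      so only the coefficients, given by \<open>deriv_F\<close> at 0 divided by
      \<open>fact n\<close>, remain to be compared.\<close>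
    have "?E 0 holomorphic_on S"
      unfolding holomorphic_on_open[OF S(1)] using S_E by blast
    then have "?F holomorphic_on S"
      unfolding F_eq by (rule holomorphic_on_mult[OF holomorphic_on_const])
    then have "?F has_fps_expansion fps_expansion ?F 0"
      using S by blast
    also have "fps_expansion ?F 0 = urn_gf \<theta> \<A> \<D> b0 w0 x y"
      by (intro fps_ext)
        (simp add: fps_expansion_def urn_gf_nth[OF fin assms(4)] deriv_F[OF S(2)] assms(8,9)
          del: of_nat_prod urn_law.simps)
    finally show ?thesis .
  qed
qed

end
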